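(* Let $k\ge1$ be an integer, $H\in\mathbb{F}_q[x]$ nonzero, and $D_1,D_2$ monic divisors of $H$. Then $$\sum_{D\mid H}\eta_k\!\left(\Big(\frac{H}{D}\Big)^k,D_1\right)\eta_k\!\left(\Big(\frac{H}{D_2}\Big)^k,D\right)=\begin{cases}|H|^k,& D_1=D_2,\\ 0,&\text{otherwise},\end{cases}$$ where the sum is over the monic divisors $D$ of $H$.
   Context: Let $\mathbb{F}_q$ be a finite field with $q$ elements and fix a non-trivial homomorphism $\lambda:(\mathbb{F}_q,+)\to\mathbb{C}^*$. For nonzero $M\in\mathbb{F}_q[x]$ of degree $m\ge1$ and $A\in\mathbb{F}_q[x]$, let $t_M(A)$ be the coefficient of $x^{m-1}$ in the remainder of $A$ on division by $M$ (if $m=0$, $t_M(A)=0$), and $E(G,M)(A)=\lambda(t_M(GA))$. For $A,B$ not both zero, $(A,B)_k$ is the monic polynomial of the form $C^k$ of largest degree dividing both $A$ and $B$. For nonzero $D$, $\eta_k(G,D)=\sum_{R}E(G,D^k)(R)$, where $R$ runs over a complete residue system modulo $D^k$ with $(R,D^k)_k=1$. $|A|=q^{\deg A}$. *)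

theory Defs
  imports Complex_Main "HOL-Computational_Algebra.Polynomial"
    "HOL-Library.Cardinality" "HOL-Number_Theory.Cong"
begin

definition top_rem_coeff :: "'a::field poly \<Rightarrow> 'a poly \<Rightarrow> 'a" where
  "top_rem_coeff M A = (if degree M = 0 then 0 else coeff (A mod M) (degree M - 1))"

definition add_char ::
    "('a::field \<Rightarrow> complex) \<Rightarrow> 'a poly \<Rightarrow> 'a poly \<Rightarrow> 'a poly \<Rightarrow> complex" where
  "add_char \<psi> G M A = \<psi> (top_rem_coeff M (G * A))"

definition is_kgcd :: "nat \<Rightarrow> 'a::field poly \<Rightarrow> 'a poly \<Rightarrow> 'a poly \<Rightarrow> bool" where
  "is_kgcd k A B P \<longleftrightarrow>
     lead_coeff P = 1 \<and> (\<exists>C. P = C ^ k) \<and> P dvd A \<and> P dvd B \<and>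
     (\<forall>C. lead_coeff (C ^ k) = 1 \<and> C ^ k dvd A \<and> C ^ k dvd B \<longrightarrow> degree (C ^ k) \<le> degree P)"

text \<open>\<open>is_kgcd k A B P\<close> has exactly one solution \<open>P\<close> unless \<open>A = B = 0\<close>; see \<open>is_kgcd_exists\<close>
  and \<open>is_kgcd_unique\<close>.\<close>

definition kgcd :: "nat \<Rightarrow> 'a::field poly \<Rightarrow> 'a poly \<Rightarrow> 'a poly" where
  "kgcd k A B = (THE P. is_kgcd k A B P)"

text \<open>The sum over a complete residue system modulo \<open>D ^ k\<close> is taken over the remainders
  modulo \<open>D ^ k\<close>; by lemma \<open>eta_complete_residue_system\<close> below, any other
  complete residue system gives the same value.\<close>

definition eta ::
    "('a::field \<Rightarrow> complex) \<Rightarrow> nat \<Rightarrow> 'a poly \<Rightarrow> 'a poly \<Rightarrow> complex" where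
  "eta \<psi> k G D =
     (\<Sum>R | R \<in> range (\<lambda>A. A mod D ^ k) \<and> kgcd k R (D ^ k) = 1. add_char \<psi> G (D ^ k) R)"

definition poly_abs :: "'a::{finite,field} poly \<Rightarrow> nat" where
  "poly_abs A = (if A = 0 then 0 else CARD('a) ^ degree A)"

definition complete_residue_system :: "'a::field poly \<Rightarrow> 'a poly set \<Rightarrow> bool" where
  "complete_residue_system M S \<longleftrightarrow> (\<forall>A. \<exists>!R. R \<in> S \<and> [R = A] (mod M))"

lemma poly_bezout:
  fixes A B :: "'a::field poly"
  shows "\<exists>G a b u v. A = G * a \<and> B = G * b \<and> u * A + v * B = G"
proof (induction "if B = 0 then 0 else Suc (degree B)" arbitrary: A B rule: less_induct)
  case less
  show ?case
  proof (cases "B = 0")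
    case True
    then have "A = A * 1 \<and> B = A * 0 \<and> 1 * A + 0 * B = A" by simp
    then show ?thesis by blast
  next
    case False
    then have "A mod B = 0 \<or> degree (A mod B) < degree B" by (rule degree_mod_less)
    with False have "(if A mod B = 0 then 0 else Suc (degree (A mod B)))
        < (if B = 0 then 0 else Suc (degree B))" by auto
    from less[OF this, of B] obtain G a b u v where
      *: "B = G * a" "A mod B = G * b" "u * B + v * (A mod B) = G" by blast
    have A: "A = (A div B) * B + A mod B" by simp
    have "A = G * ((A div B) * a + b)"
    proof -
      have "G * ((A div B) * a + b) = (A div B) * (G * a) + G * b" by (simp add: algebra_simps)
      then show ?thesis using A unfolding *(1)[symmetric] *(2)[symmetric] by simp
    qed
    moreover have "v * A + (u - v * (A div B)) * B = G"
    proof -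
      have "v * A + (u - v * (A div B)) * B = u * B + v * (A - (A div B) * B)"
        by (simp add: algebra_simps)
      also have "A - (A div B) * B = A mod B" by (simp add: minus_div_mult_eq_mod)
      finally show ?thesis using *(3) by simp
    qed
    ultimately show ?thesis using *(1) by blast
  qed
qed

lemma is_kgcd_exists:
  fixes A B :: "'a::field poly"
  assumes "A \<noteq> 0 \<or> B \<noteq> 0"
  shows "\<exists>P. is_kgcd k A B P"
proof -
  let ?Q = "\<lambda>C. lead_coeff (C ^ k) = 1 \<and> C ^ k dvd A \<and> C ^ k dvd B"
  have "?Q 1" by simp
  moreover have "\<forall>C. ?Q C \<longrightarrow> degree (C ^ k) < Suc (degree A + degree B)"
    using assms by (auto dest!: dvd_imp_degree_le)
  ultimately obtain C where "?Q C" "\<forall>C'. ?Q C' \<longrightarrow> degree (C' ^ k) \<le> degree (C ^ k)"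
    using ex_has_greatest_nat[of ?Q 1 "\<lambda>C. degree (C ^ k)" "Suc (degree A + degree B)"]
    by blast
  then show ?thesis unfolding is_kgcd_def by blast
qed

lemma is_kgcd_unique:
  fixes A B :: "'a::field poly"
  assumes nz: "A \<noteq> 0 \<or> B \<noteq> 0" and P: "is_kgcd k A B P" and Q: "is_kgcd k A B Q"
  shows "P = Q"
proof -
  obtain C D where C: "P = C ^ k" and D: "Q = D ^ k"
    using P Q unfolding is_kgcd_def by blast
  obtain G c d u v where G: "C = G * c" "D = G * d" "u * C + v * D = G"
    using poly_bezout by blast
  show ?thesis
  proof (cases "k = 0 \<or> G = 0")
    case True
    then show ?thesis using C D G by auto
  next
    case False
    have "G * (u * c + v * d) = G * 1" using G by (simp add: algebra_simps)
    then have uv: "u * c + v * d = 1" using False by (metis mult_cancel_left)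
    have nzP: "P \<noteq> 0" "Q \<noteq> 0" using P Q unfolding is_kgcd_def by auto
    have nzk: "G ^ k \<noteq> 0" "c ^ k \<noteq> 0" "d ^ k \<noteq> 0"
      using nzP C D G by (auto simp: power_mult_distrib)
    define L where "L = (G * c * d) ^ k"
    have Ldvd: "L dvd X" if PX: "P dvd X" and QX: "Q dvd X" for X
    proof -
      obtain x where x: "X = G ^ k * c ^ k * x"
        using PX unfolding C G(1) power_mult_distrib dvd_def by blast
      obtain y where y: "X = G ^ k * d ^ k * y"
        using QX unfolding D G(2) power_mult_distrib dvd_def by blast
      have cd: "c ^ k * x = d ^ k * y" using x y nzk(1) by (auto simp: mult.assoc)
      have "\<exists>a b. a * c ^ k + b * d ^ k = 1"
      proof -
        have 1: "\<exists>a b. a * c ^ n + b * d = 1" for n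
        proof (induction n)
          case 0 show ?case by (rule exI[of _ 1], rule exI[of _ 0]) simp
        next
          case (Suc n)
          then obtain a b where ab: "a * c ^ n + b * d = 1" by blast
          have "1 = (a * c ^ n + b * d) * (u * c + v * d)" using ab uv by simp
          also have "\<dots> = (a * u) * c ^ Suc n + (a * c ^ n * v + b * u * c + b * v * d) * d"
            by (simp add: algebra_simps)
          finally show ?case by (intro exI) (rule sym)
        qed
        obtain a b where ab: "a * c ^ k + b * d = 1" using 1 by blast
        have "\<exists>a b. a * c ^ k + b * d ^ n = 1" for n
        proof (induction n)
          case 0 show ?case by (rule exI[of _ 0], rule exI[of _ 1]) simp
        next
          case (Suc n)
          then obtain a' b' where ab': "a' * c ^ k + b' * d ^ n = 1" by blast
          have "1 = (a' * c ^ k + b' * d ^ n) * (a * c ^ k + b * d)" using ab ab' by simp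
          also have "\<dots> = (a' * a * c ^ k + a' * b * d + b' * d ^ n * a) * c ^ k
              + (b' * b) * d ^ Suc n"
            by (simp add: algebra_simps)
          finally show ?case by (intro exI) (rule sym)
        qed
        then show ?thesis by blast
      qed
      then obtain a b where ab: "a * c ^ k + b * d ^ k = 1" by blast
      have "x = (a * c ^ k + b * d ^ k) * x" using ab by simp
      also have "\<dots> = a * (c ^ k * x) + b * d ^ k * x" by (simp add: algebra_simps)
      also have "\<dots> = d ^ k * (a * y + b * x)"
        by (subst cd) (simp add: algebra_simps)
      finally have "d ^ k dvd x" by (rule dvdI)
      then show ?thesis unfolding x L_def power_mult_distrib by (intro mult_dvd_mono dvd_refl)
    qed
    have mon: "lead_coeff G ^ k * lead_coeff c ^ k = 1" "lead_coeff G ^ k * lead_coeff d ^ k = 1"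
      using P Q C D G unfolding is_kgcd_def
      by (auto simp: lead_coeff_power lead_coeff_mult power_mult_distrib)
    define e where "e = [:inverse (lead_coeff d):]"
    have nzlc: "lead_coeff d \<noteq> 0" "lead_coeff c \<noteq> 0"
      using nzk False by (auto simp: power_eq_0_iff)
    define M where "M = G * c * d * e"
    have unit: "L dvd X \<Longrightarrow> M ^ k dvd X" for X
    proof -
      assume "L dvd X"
      moreover have "e * [:lead_coeff d:] = 1" using nzlc by (simp add: e_def one_pCons)
      then have "M * [:lead_coeff d:] = G * c * d" by (simp only: M_def mult.assoc mult_1_right)
      then have "L = M ^ k * [:lead_coeff d:] ^ k"
        unfolding L_def power_mult_distrib[symmetric] by simp
      ultimately show "M ^ k dvd X" using dvd_mult_left by blast
    qed
    have lcM: "lead_coeff (M ^ k) = 1"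
      using mon nzlc unfolding M_def e_def
      by (simp add: lead_coeff_power lead_coeff_mult power_mult_distrib field_simps)
    have dvds: "M ^ k dvd A" "M ^ k dvd B"
      using P Q unit Ldvd unfolding is_kgcd_def by blast+
    have nzs: "G \<noteq> 0" "c \<noteq> 0" "d \<noteq> 0" using False nzlc by auto
    have enz: "e \<noteq> 0" "degree e = 0" using nzlc by (auto simp: e_def)
    have "degree (M ^ k) \<le> degree P" "degree (M ^ k) \<le> degree Q"
      using P Q lcM dvds unfolding is_kgcd_def by blast+
    then have "degree d = 0" "degree c = 0"
      using nzs enz False unfolding M_def C D G(1,2)
      by (auto simp: degree_power_eq degree_mult_eq)
    then obtain c0 d0 where "c = [:c0:]" "d = [:d0:]" by (metis degree_eq_zeroE)
    then have "c0 ^ k = d0 ^ k" using mon by (metis lead_coeff_pCons(2) mult_cancel_left mult_zero_left zero_neq_one)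
    then have "c ^ k = d ^ k" using \<open>c = _\<close> \<open>d = _\<close> by (simp add: poly_const_pow)
    then show ?thesis using C D G by (simp add: power_mult_distrib)
  qed
qed

lemma is_kgcd_kgcd:
  fixes A B :: "'a::field poly"
  assumes "A \<noteq> 0 \<or> B \<noteq> 0"
  shows "is_kgcd k A B (kgcd k A B)"
  unfolding kgcd_def by (rule theI') (use is_kgcd_exists[OF assms] is_kgcd_unique[OF assms] in blast)

lemma eta_complete_residue_system:
  fixes D :: "'a::field poly"
  assumes S: "complete_residue_system (D ^ k) S"
  shows "eta \<psi> k G D = (\<Sum>R | R \<in> S \<and> kgcd k R (D ^ k) = 1. add_char \<psi> G (D ^ k) R)"
proof -
  let ?M = "D ^ k"
  have kg: "kgcd k (R mod ?M) ?M = kgcd k R ?M" for R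
  proof -
    have "P dvd R mod ?M \<longleftrightarrow> P dvd R" if "P dvd ?M" for P
      using that by (rule dvd_mod_iff)
    then have "is_kgcd k (R mod ?M) ?M = is_kgcd k R ?M"
      unfolding is_kgcd_def fun_eq_iff by blast
    then show ?thesis by (simp add: kgcd_def)
  qed
  have ch: "add_char \<psi> G ?M (R mod ?M) = add_char \<psi> G ?M R" for R
    by (simp add: add_char_def top_rem_coeff_def mod_mult_right_eq)
  have inj: "R = R'" if "R \<in> S" "R' \<in> S" "R mod ?M = R' mod ?M" for R R'
    using S that unfolding complete_residue_system_def cong_def by metis
  have ex: "\<exists>R\<in>S. R mod ?M = A mod ?M" for A
    using S unfolding complete_residue_system_def cong_def by metis
  have "bij_betw (\<lambda>R. R mod ?M) {R. R \<in> S \<and> kgcd k R ?M = 1}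
      {R. R \<in> range (\<lambda>A. A mod ?M) \<and> kgcd k R ?M = 1}"
    unfolding bij_betw_def
  proof (intro conjI inj_onI set_eqI iffI)
    fix R assume "R \<in> {R. R \<in> range (\<lambda>A. A mod ?M) \<and> kgcd k R ?M = 1}"
    then obtain A where "R = A mod ?M" "kgcd k R ?M = 1" by blast
    moreover obtain R' where "R' \<in> S" "R' mod ?M = A mod ?M" using ex by blast
    ultimately show "R \<in> (\<lambda>R. R mod ?M) ` {R. R \<in> S \<and> kgcd k R ?M = 1}"
      using kg[of R'] by (intro image_eqI[of _ _ R']) auto
  qed (auto simp: kg intro: inj)
  then have "(\<Sum>R | R \<in> S \<and> kgcd k R ?M = 1. add_char \<psi> G ?M (R mod ?M)) = eta \<psi> k G D"
    unfolding eta_def by (rule sum.reindex_bij_betw)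
  then show ?thesis by (simp add: ch)
qed

end

theory Submission
  imports Defs
begin

text \<open>Sorting the residues modulo \<open>D ^ k\<close> by their \<open>k\<close>-th power gcd with \<open>D ^ k\<close> gives
  \<open>\<Sum>d | D. \<eta>(G, d) = |D| ^ k\<close> if \<open>D ^ k\<close> divides \<open>G\<close> and \<open>0\<close> otherwise. Let \<open>T(D1)\<close> be the sum of the
  theorem. Applying this identity first to the factor \<open>\<eta>((H / D) ^ k, d)\<close> and then to the remaining sum
  over \<open>D | H / E\<close> yields \<open>\<Sum>d | E. T(d) = |H| ^ k\<close> if \<open>D2\<close> divides \<open>E\<close> and \<open>0\<close> otherwise, and these
  divisor sums determine \<open>T\<close>.\<close>

section \<open>Comaximal elements\<close>

definition comaximal :: "'a::comm_ring_1 \<Rightarrow> 'a \<Rightarrow> bool" where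
  "comaximal a b \<longleftrightarrow> (\<exists>u v. u * a + v * b = 1)"

lemma comaximal_commute: "comaximal a b \<longleftrightarrow> comaximal b a"
  unfolding comaximal_def by (metis add.commute)

lemma comaximal_mult_right:
  assumes "comaximal a b" and "comaximal a c"
  shows "comaximal a (b * c)"
proof -
  obtain u v x y where "u * a + v * b = 1" and "x * a + y * c = 1"
    using assms unfolding comaximal_def by blast
  then have "1 = (u * a + v * b) * (x * a + y * c)" by simp
  also have "\<dots> = (u * a * x + u * y * c + v * b * x) * a + (v * y) * (b * c)"
    by (simp add: algebra_simps)
  finally show ?thesis unfolding comaximal_def by metis
qed

lemma comaximal_power_right: "comaximal a b \<Longrightarrow> comaximal a (b ^ n)"
proof (induction n)
  case 0
  have "0 * a + 1 * b ^ 0 = 1" by simp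
  then show ?case unfolding comaximal_def by blast
qed (simp add: comaximal_mult_right)

lemma comaximal_power_power: "comaximal a b \<Longrightarrow> comaximal (a ^ m) (b ^ n)"
  by (metis comaximal_commute comaximal_power_right)

lemma comaximal_mult_dvd:
  assumes "comaximal a b" and a: "g * a dvd x" and b: "g * b dvd x"
  shows "g * a * b dvd x"
proof -
  obtain u v where "u * a + v * b = 1" using assms(1) unfolding comaximal_def by blast
  then have "x = x * (u * a + v * b)" by simp
  also have "\<dots> = u * (x * a) + v * (x * b)" by (simp add: algebra_simps)
  finally have "x = u * (x * a) + v * (x * b)" .
  moreover have "g * a * b dvd x * a" using mult_dvd_mono[OF b dvd_refl[of a]] by (simp add: ac_simps)
  moreover have "g * a * b dvd x * b" using mult_dvd_mono[OF a dvd_refl[of b]] .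
  ultimately show ?thesis by (metis dvd_add dvd_mult)
qed

lemma comaximal_dvd_imp_is_unit: "comaximal a b \<Longrightarrow> a dvd b \<Longrightarrow> is_unit a"
  unfolding comaximal_def by (metis dvd_add dvd_mult dvd_refl)

section \<open>Powers and monic divisors of polynomials\<close>

lemma poly_comaximal_cofactorsE:
  fixes A B :: "'a::field poly"
  assumes "A \<noteq> 0"
  obtains G a b where "A = G * a" "B = G * b" "G \<noteq> 0" "comaximal a b"
proof -
  obtain G a b u v where *: "A = G * a" "B = G * b" "u * A + v * B = G"
    using poly_bezout by blast
  have "G \<noteq> 0" using assms *(1) by auto
  moreover have "G * (u * a + v * b) = G * 1" using * by (simp add: algebra_simps)
  ultimately have "comaximal a b" unfolding comaximal_def by (metis mult_cancel_left)
  with that * \<open>G \<noteq> 0\<close> show ?thesis by blast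
qed

lemma poly_power_dvd_power_iff:
  fixes A B :: "'a::field poly"
  assumes "A \<noteq> 0" and "k > 0"
  shows "A ^ k dvd B ^ k \<longleftrightarrow> A dvd B"
proof
  assume dvd: "A ^ k dvd B ^ k"
  obtain G a b where *: "A = G * a" "B = G * b" "G \<noteq> 0" "comaximal a b"
    using poly_comaximal_cofactorsE[OF assms(1)] by blast
  have "a ^ k dvd b ^ k" using dvd * by (simp add: power_mult_distrib)
  then have "is_unit (a ^ k)"
    using comaximal_power_power[OF *(4)] comaximal_dvd_imp_is_unit by blast
  then have "is_unit a" using assms(2) by (simp add: is_unit_power_iff)
  then show "A dvd B" unfolding * by (rule mult_dvd_mono[OF dvd_refl unit_imp_dvd])
qed (rule dvd_power_same)

lemma poly_power_lcmE:
  fixes A B :: "'a::field poly"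
  assumes "A \<noteq> 0"
  obtains c where "B dvd A * c" "\<And>X. A ^ k dvd X \<Longrightarrow> B ^ k dvd X \<Longrightarrow> (A * c) ^ k dvd X"
proof -
  obtain G a b where *: "A = G * a" "B = G * b" "comaximal a b"
    using poly_comaximal_cofactorsE[OF assms] by blast
  have "B dvd A * b" by (simp add: * mult.assoc)
  moreover have "(A * b) ^ k dvd X" if "A ^ k dvd X" "B ^ k dvd X" for X
    using that comaximal_mult_dvd[OF comaximal_power_power[OF *(3)], of "G ^ k" k X k]
    by (simp add: * power_mult_distrib)
  ultimately show ?thesis using that by blast
qed

lemma monic_associateE:
  fixes A :: "'a::field poly"
  assumes "A \<noteq> 0"
  obtains C where "lead_coeff C = 1" "degree C = degree A" "C dvd A" "A dvd C"
proof
  let ?C = "smult (inverse (lead_coeff A)) A"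
  show "lead_coeff ?C = 1" "degree ?C = degree A" using assms by auto
  show "?C dvd A" "A dvd ?C" using assms by (auto simp: smult_dvd_iff dvd_smult)
qed

lemma monic_dvd_antisym:
  fixes C D :: "'a::field poly"
  assumes "lead_coeff C = 1" "lead_coeff D = 1" "C dvd D" "D dvd C"
  shows "C = D"
proof -
  obtain E where E: "D = C * E" using assms(3) by blast
  have "D \<noteq> 0" using assms(2) by auto
  then have "is_unit E" using E assms(4) by (metis dvd_mult_cancel_left mult.right_neutral mult_eq_0_iff)
  then obtain e where e: "E = [:e:]" by (auto simp: is_unit_poly_iff)
  then have "lead_coeff D = e * lead_coeff C" using E by (simp add: lead_coeff_mult)
  then have "e = 1" using assms(1,2) by simp
  then show ?thesis using E e by (simp flip: one_pCons)
qed

lemma inj_on_monic_power: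
  assumes "k > 0"
  shows "inj_on (\<lambda>C. C ^ k) {C :: 'a::field poly. lead_coeff C = 1}"
proof (rule inj_onI)
  fix C D :: "'a poly"
  assume monic: "C \<in> {C. lead_coeff C = 1}" "D \<in> {C. lead_coeff C = 1}" and eq: "C ^ k = D ^ k"
  then have "C \<noteq> 0" "D \<noteq> 0" by auto
  then have "C dvd D" "D dvd C"
    using eq poly_power_dvd_power_iff[OF _ assms] by (metis dvd_refl)+
  then show "C = D" using monic by (intro monic_dvd_antisym) auto
qed

definition monic_divisors :: "'a::field poly \<Rightarrow> 'a poly set" where
  "monic_divisors A = {D. lead_coeff D = 1 \<and> D dvd A}"

lemma monic_divisors_cong: "A dvd B \<Longrightarrow> B dvd A \<Longrightarrow> monic_divisors A = monic_divisors B"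
  unfolding monic_divisors_def by (auto intro: dvd_trans)

lemma lead_coeff_div_monic:
  fixes D d :: "'a::field poly"
  assumes "lead_coeff D = 1" and "d \<in> monic_divisors D"
  shows "lead_coeff (D div d) = 1"
proof -
  have "lead_coeff (D div d * d) = 1" using assms by (simp add: monic_divisors_def)
  then show ?thesis using assms(2) by (simp add: lead_coeff_mult monic_divisors_def)
qed

lemma bij_betw_div_monic_divisors:
  fixes D :: "'a::field poly"
  assumes "lead_coeff D = 1"
  shows "bij_betw ((div) D) (monic_divisors D) (monic_divisors D)"
proof -
  have "D \<noteq> 0" using assms by auto
  then have involution: "\<forall>d\<in>monic_divisors D. D div (D div d) = d"
    by (auto simp: monic_divisors_def div_div_eq_right)
  have closed: "(div) D ` monic_divisors D \<subseteq> monic_divisors D"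
    using lead_coeff_div_monic[OF assms] by (auto simp: monic_divisors_def)
  show ?thesis by (rule bij_betw_byWitness[OF involution involution closed closed])
qed

lemma monic_divisors_div:
  fixes E H :: "'a::field poly"
  assumes "H \<noteq> 0" and "E dvd H"
  shows "monic_divisors (H div E) = {D \<in> monic_divisors H. E dvd H div D}"
proof -
  have "D dvd H div E \<longleftrightarrow> D dvd H \<and> E dvd H div D" for D
  proof (cases "D dvd H")
    case True
    then have "D \<noteq> 0" "E \<noteq> 0" using assms by auto
    then show ?thesis using True assms(2) by (simp add: dvd_div_iff_mult mult.commute)
  next
    case False
    then show ?thesis using assms(2) by (metis dvd_mult2 dvd_div_mult_self)
  qed
  then show ?thesis unfolding monic_divisors_def by blast
qed

section \<open>The \<open>k\<close>-th power gcd\<close>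

lemma power_dvd_kgcd_iff:
  fixes A B C :: "'a::field poly"
  assumes nz: "A \<noteq> 0 \<or> B \<noteq> 0"
  shows "C ^ k dvd kgcd k A B \<longleftrightarrow> C ^ k dvd A \<and> C ^ k dvd B"
proof (cases "k = 0")
  case False
  obtain E where E: "kgcd k A B = E ^ k" "lead_coeff (E ^ k) = 1" "E ^ k dvd A" "E ^ k dvd B"
    and max: "\<And>F. lead_coeff (F ^ k) = 1 \<Longrightarrow> F ^ k dvd A \<Longrightarrow> F ^ k dvd B
      \<Longrightarrow> degree (F ^ k) \<le> degree (E ^ k)"
    using is_kgcd_kgcd[OF nz, of k] unfolding is_kgcd_def by metis
  have "C ^ k dvd E ^ k" if C: "C ^ k dvd A" "C ^ k dvd B"
  proof -
    have "E \<noteq> 0" using E(2) False by (auto simp: power_0_left)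
    \<comment> \<open>\<open>E * c\<close> is a least common multiple of \<open>E\<close> and \<open>C\<close>, so \<open>c\<close> is a unit by maximality of \<open>E\<close>.\<close>
    then obtain c where c: "C dvd E * c" "(E * c) ^ k dvd A" "(E * c) ^ k dvd B"
      using E(3,4) C poly_power_lcmE[of E C k] by metis
    then have "c \<noteq> 0" using nz False by auto
    then obtain F where F: "lead_coeff F = 1" "degree F = degree (E * c)" "F dvd E * c"
      using \<open>E \<noteq> 0\<close> monic_associateE[of "E * c"] by auto
    have "degree (F ^ k) \<le> degree (E ^ k)"
      using dvd_trans[OF dvd_power_same[OF F(3)]] c(2,3) F(1)
      by (intro max) (simp_all add: lead_coeff_power)
    moreover have "F \<noteq> 0" using F(1) by auto
    ultimately have "degree c = 0"
      using False F(2) \<open>E \<noteq> 0\<close> \<open>c \<noteq> 0\<close> by (simp add: degree_power_eq degree_mult_eq)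
    then have "is_unit c" using \<open>c \<noteq> 0\<close> by (simp add: is_unit_iff_degree)
    then have "C dvd E" using c(1) by (simp add: dvd_mult_unit_iff)
    then show ?thesis by (rule dvd_power_same)
  qed
  then show ?thesis using E by (metis dvd_trans)
qed simp

lemma kgcd_power_mult:
  fixes A B C :: "'a::field poly"
  assumes C: "lead_coeff C = 1" and nz: "A \<noteq> 0 \<or> B \<noteq> 0" and "k > 0"
  shows "kgcd k (C ^ k * A) (C ^ k * B) = C ^ k * kgcd k A B"
proof (rule monic_dvd_antisym)
  have "C \<noteq> 0" using C by auto
  then have nz': "C ^ k * A \<noteq> 0 \<or> C ^ k * B \<noteq> 0" using nz by simp
  obtain E where E: "kgcd k A B = E ^ k" "lead_coeff (E ^ k) = 1"
    using is_kgcd_kgcd[OF nz] unfolding is_kgcd_def by metis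
  obtain F where F: "kgcd k (C ^ k * A) (C ^ k * B) = F ^ k" "lead_coeff (F ^ k) = 1"
    using is_kgcd_kgcd[OF nz'] unfolding is_kgcd_def by metis
  have "C ^ k dvd F ^ k" using power_dvd_kgcd_iff[OF nz', of C k] F(1) by simp
  then have "C dvd F" using poly_power_dvd_power_iff[OF \<open>C \<noteq> 0\<close> \<open>k > 0\<close>] by blast
  then obtain F' where F': "F = C * F'" by blast
  have "F ^ k dvd C ^ k * A" "F ^ k dvd C ^ k * B"
    using power_dvd_kgcd_iff[OF nz', of F k] F(1) by simp_all
  then have "F' ^ k dvd kgcd k A B"
    using \<open>C \<noteq> 0\<close> by (simp add: power_dvd_kgcd_iff[OF nz] F' power_mult_distrib)
  then show "kgcd k (C ^ k * A) (C ^ k * B) dvd C ^ k * kgcd k A B"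
    unfolding F(1) F' power_mult_distrib by (rule mult_dvd_mono[OF dvd_refl])
  have "E ^ k dvd A" "E ^ k dvd B" using power_dvd_kgcd_iff[OF nz, of E k] E(1) by simp_all
  then show "C ^ k * kgcd k A B dvd kgcd k (C ^ k * A) (C ^ k * B)"
    using power_dvd_kgcd_iff[OF nz', of "C * E" k] by (simp add: E(1) power_mult_distrib)
  show "lead_coeff (kgcd k (C ^ k * A) (C ^ k * B)) = 1" "lead_coeff (C ^ k * kgcd k A B) = 1"
    using C E F by (simp_all add: lead_coeff_mult lead_coeff_power)
qed

lemma kgcd_in_power_monic_divisors:
  fixes A D :: "'a::field poly"
  assumes "D \<noteq> 0" and "k > 0"
  shows "kgcd k A (D ^ k) \<in> (\<lambda>C. C ^ k) ` monic_divisors D"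
proof -
  obtain E where E: "kgcd k A (D ^ k) = E ^ k" "lead_coeff (E ^ k) = 1" "E ^ k dvd D ^ k"
    using is_kgcd_kgcd[of A "D ^ k" k] assms(1) unfolding is_kgcd_def by auto
  then have "E \<noteq> 0" using assms(2) by (auto simp: power_0_left)
  then obtain C where C: "lead_coeff C = 1" "C dvd E" "E dvd C"
    using monic_associateE by blast
  have "E dvd D" using E(3) poly_power_dvd_power_iff[OF \<open>E \<noteq> 0\<close> assms(2)] by blast
  with C(2) have "C dvd D" by (rule dvd_trans)
  moreover have "E ^ k = C ^ k"
    using C E(2) by (intro monic_dvd_antisym dvd_power_same) (simp_all add: lead_coeff_power)
  ultimately show ?thesis using C(1) E(1) by (auto simp: monic_divisors_def)
qed

section \<open>Polynomials of bounded degree\<close>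

text \<open>Coefficients instead of degrees, since the zero polynomial has degree \<open>0\<close>.\<close>

definition polys_degree_less :: "nat \<Rightarrow> 'a::zero poly set" where
  "polys_degree_less n = {p. \<forall>i\<ge>n. coeff p i = 0}"

lemma polys_degree_less_iff: "p \<in> polys_degree_less n \<longleftrightarrow> p = 0 \<or> degree p < n"
  unfolding polys_degree_less_def
  by (auto intro: coeff_eq_0) (metis leading_coeff_0_iff linorder_not_less)

lemma polys_degree_less_0: "polys_degree_less 0 = {0}"
  by (auto simp: polys_degree_less_iff)

lemma bij_betw_pCons_polys_degree_less:
  "bij_betw (\<lambda>(a, p). pCons a p) (UNIV \<times> polys_degree_less n)
    (polys_degree_less (Suc n) :: 'a::zero poly set)"
  unfolding bij_betw_def
proof (intro conjI)
  show "(\<lambda>(a, p). pCons a p) ` (UNIV \<times> polys_degree_less n) = (polys_degree_less (Suc n) :: 'a poly set)"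
  proof (intro equalityI subsetI)
    fix p :: "'a poly" assume p: "p \<in> polys_degree_less (Suc n)"
    obtain a q where q: "p = pCons a q" by (cases p)
    have "coeff q i = 0" if "i \<ge> n" for i
      using p that unfolding q polys_degree_less_def by (auto dest: spec[of _ "Suc i"])
    then show "p \<in> (\<lambda>(a, p). pCons a p) ` (UNIV \<times> polys_degree_less n)"
      using q by (auto simp: polys_degree_less_def)
  qed (auto simp: polys_degree_less_def coeff_pCons split: nat.split)
qed (auto simp: inj_on_def)

lemma finite_polys_degree_less: "finite (polys_degree_less n :: 'a::{finite,zero} poly set)"
  by (induction n)
    (simp_all add: polys_degree_less_0 bij_betw_finite[OF bij_betw_pCons_polys_degree_less, symmetric])

lemma card_polys_degree_less: "card (polys_degree_less n :: 'a::{finite,zero} poly set) = CARD('a) ^ n"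
  by (induction n)
    (simp_all add: polys_degree_less_0 card_cartesian_product
      bij_betw_same_card[OF bij_betw_pCons_polys_degree_less, symmetric])

lemma finite_monic_divisors:
  fixes H :: "'a::{finite,field} poly"
  assumes "H \<noteq> 0"
  shows "finite (monic_divisors H)"
proof (rule finite_subset)
  show "monic_divisors H \<subseteq> polys_degree_less (Suc (degree H))"
  proof
    fix D assume "D \<in> monic_divisors H"
    then have "degree D \<le> degree H" using assms by (auto simp: monic_divisors_def dvd_imp_degree_le)
    then show "D \<in> polys_degree_less (Suc (degree H))" by (simp add: polys_degree_less_iff)
  qed
qed (rule finite_polys_degree_less)

lemma eq_if_monic_divisor_sums_eq:
  fixes f g :: "'a::{finite,field} poly \<Rightarrow> 'b::cancel_comm_monoid_add"
  assumes eq: "\<And>E. E \<in> monic_divisors H \<Longrightarrow> sum f (monic_divisors E) = sum g (monic_divisors E)"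
    and "D \<in> monic_divisors H"
  shows "f D = g D"
  using assms(2)
proof (induction D rule: measure_induct_rule[of degree])
  case (less D)
  then have D: "D \<noteq> 0" "lead_coeff D = 1" "D dvd H" by (auto simp: monic_divisors_def)
  have "f d = g d" if "d \<in> monic_divisors D - {D}" for d
  proof (rule less.IH)
    have d: "lead_coeff d = 1" "d dvd D" "d \<noteq> D" using that by (auto simp: monic_divisors_def)
    then obtain e where e: "D = d * e" by blast
    have "\<not> D dvd d" using d D(2) monic_dvd_antisym by metis
    then have "\<not> is_unit e" unfolding e by (metis dvd_refl mult_unit_dvd_iff)
    then show "degree d < degree D"
      using e D(1) by (auto simp: degree_mult_eq is_unit_iff_degree)
    show "d \<in> monic_divisors H" using d D(3) by (auto simp: monic_divisors_def intro: dvd_trans)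
  qed
  then have "sum f (monic_divisors D - {D}) = sum g (monic_divisors D - {D})" by (rule sum.cong[OF refl])
  moreover have "D \<in> monic_divisors D" using D(2) by (simp add: monic_divisors_def)
  ultimately show ?case
    using eq[OF less.prems] finite_monic_divisors[OF D(1)] by (simp add: sum.remove)
qed

section \<open>Remainders\<close>

definition remainders :: "'a::field poly \<Rightarrow> 'a poly set" where
  "remainders M = range (\<lambda>A. A mod M)"

lemma remainders_iff: "R \<in> remainders M \<longleftrightarrow> R mod M = R"
  unfolding remainders_def by (auto intro: image_eqI[of _ _ R])

lemma remainders_eq_polys_degree_less:
  fixes M :: "'a::field poly"
  assumes "M \<noteq> 0"
  shows "remainders M = polys_degree_less (degree M)"
proof -
  have "R mod M = R \<longleftrightarrow> R = 0 \<or> degree R < degree M" for R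
    using degree_mod_less[OF assms, of R] by (metis mod_0 mod_poly_less)
  then show ?thesis by (auto simp: remainders_iff polys_degree_less_iff)
qed

lemma finite_remainders: "M \<noteq> 0 \<Longrightarrow> finite (remainders (M :: 'a::{finite,field} poly))"
  by (simp add: remainders_eq_polys_degree_less finite_polys_degree_less)

lemma card_remainders: "M \<noteq> 0 \<Longrightarrow> card (remainders M) = poly_abs M"
  by (simp add: remainders_eq_polys_degree_less card_polys_degree_less poly_abs_def)

lemma mult_in_remainders_iff:
  "C \<noteq> 0 \<Longrightarrow> C * R \<in> remainders (C * M) \<longleftrightarrow> R \<in> remainders M"
  by (simp add: remainders_iff mod_mult_mult1)

definition reduced_remainders :: "nat \<Rightarrow> 'a::field poly \<Rightarrow> 'a poly set" where
  "reduced_remainders k D = {R \<in> remainders (D ^ k). kgcd k R (D ^ k) = 1}"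

lemma eta_eq_sum_reduced_remainders:
  "eta \<psi> k G D = (\<Sum>R\<in>reduced_remainders k D. add_char \<psi> G (D ^ k) R)"
  by (simp add: eta_def reduced_remainders_def remainders_def)

lemma bij_betw_reduced_remainders:
  fixes C D :: "'a::field poly"
  assumes C: "lead_coeff C = 1" and D: "D \<noteq> 0" and k: "k > 0"
  shows "bij_betw ((*) (C ^ k)) (reduced_remainders k D)
    {Q \<in> remainders ((C * D) ^ k). kgcd k Q ((C * D) ^ k) = C ^ k}"
proof -
  have nz: "C \<noteq> 0" "C ^ k \<noteq> 0" using C by auto
  have mem: "C ^ k * R \<in> remainders ((C * D) ^ k) \<and> kgcd k (C ^ k * R) ((C * D) ^ k) = C ^ k
      \<longleftrightarrow> R \<in> reduced_remainders k D" for R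
    using nz D mult_in_remainders_iff[OF nz(2)] kgcd_power_mult[OF C _ k, of R "D ^ k"]
    by (simp add: power_mult_distrib reduced_remainders_def)
  have "C ^ k dvd Q" if "kgcd k Q ((C * D) ^ k) = C ^ k" for Q
    using that C D power_dvd_kgcd_iff[of Q "(C * D) ^ k" C k] by auto
  then have "{Q \<in> remainders ((C * D) ^ k). kgcd k Q ((C * D) ^ k) = C ^ k}
      = (*) (C ^ k) ` reduced_remainders k D"
    using mem by (auto elim!: dvdE)
  moreover have "inj_on ((*) (C ^ k)) (reduced_remainders k D)" using nz by (simp add: inj_on_def)
  ultimately show ?thesis by (simp add: bij_betw_def)
qed

lemma sum_remainders_power:
  fixes f :: "'a::{finite,field} poly \<Rightarrow> 'b::comm_monoid_add"
  assumes D: "lead_coeff D = 1" and k: "k > 0"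
  shows "(\<Sum>Q\<in>remainders (D ^ k). f Q)
    = (\<Sum>d\<in>monic_divisors D. \<Sum>R\<in>reduced_remainders k d. f ((D div d) ^ k * R))"
proof -
  have nz: "D \<noteq> 0" using D by auto
  define fibre where "fibre P = {Q \<in> remainders (D ^ k). kgcd k Q (D ^ k) = P}" for P
  have "(\<Sum>Q\<in>remainders (D ^ k). f Q) = (\<Sum>P\<in>(\<lambda>C. C ^ k) ` monic_divisors D. sum f (fibre P))"
    unfolding fibre_def
    by (rule sum.group[symmetric])
      (use nz k in \<open>auto simp: finite_remainders finite_monic_divisors kgcd_in_power_monic_divisors\<close>)
  also have "\<dots> = (\<Sum>C\<in>monic_divisors D. sum f (fibre (C ^ k)))"
    by (rule sum.reindex_cong[OF inj_on_subset[OF inj_on_monic_power[OF k]]])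
      (auto simp: monic_divisors_def)
  also have "\<dots> = (\<Sum>d\<in>monic_divisors D. sum f (fibre ((D div d) ^ k)))"
    by (rule sum.reindex_bij_betw[OF bij_betw_div_monic_divisors[OF D], symmetric])
  also have "\<dots> = (\<Sum>d\<in>monic_divisors D. \<Sum>R\<in>reduced_remainders k d. f ((D div d) ^ k * R))"
  proof (rule sum.cong[OF refl])
    fix d assume d: "d \<in> monic_divisors D"
    then have "d \<noteq> 0" "D div d * d = D" by (auto simp: monic_divisors_def)
    then have "bij_betw ((*) ((D div d) ^ k)) (reduced_remainders k d) (fibre ((D div d) ^ k))"
      using bij_betw_reduced_remainders[OF lead_coeff_div_monic[OF D d] _ k, of d]
      by (simp add: fibre_def)
    then show "sum f (fibre ((D div d) ^ k)) = (\<Sum>R\<in>reduced_remainders k d. f ((D div d) ^ k * R))"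
      by (rule sum.reindex_bij_betw[symmetric])
  qed
  finally show ?thesis .
qed

section \<open>Character sums\<close>

lemma coeff_mult_degree_add:
  fixes p q :: "'a::comm_semiring_0 poly"
  assumes "degree q \<le> n"
  shows "coeff (p * q) (degree p + n) = lead_coeff p * coeff q n"
proof (cases "degree q = n")
  case True
  then show ?thesis using coeff_mult_degree_sum[of p q] by simp
next
  case False
  then have "degree q < n" using assms by simp
  moreover from this have "degree (p * q) < degree p + n" using degree_mult_le[of p q] by linarith
  ultimately show ?thesis by (simp add: coeff_eq_0)
qed

lemma top_rem_coeff_eq_coeff_mod:
  "M \<noteq> 0 \<Longrightarrow> top_rem_coeff M A = coeff (A mod M) (degree M - 1)"
  using degree_mod_less[of M A] by (auto simp: top_rem_coeff_def)

lemma top_rem_coeff_mod_mult_right: "top_rem_coeff M (A * (B mod M)) = top_rem_coeff M (A * B)"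
  by (simp add: top_rem_coeff_def mod_mult_right_eq)

lemma top_rem_coeff_add: "top_rem_coeff M (A + B) = top_rem_coeff M A + top_rem_coeff M B"
  by (simp add: top_rem_coeff_def poly_mod_add_left)

lemma top_rem_coeff_mult_mult:
  fixes C M A :: "'a::field poly"
  assumes "C \<noteq> 0" and "M \<noteq> 0"
  shows "top_rem_coeff (C * M) (C * A) = lead_coeff C * top_rem_coeff M A"
proof (cases "degree M = 0")
  case True
  then have "A mod M = 0" using degree_mod_less[OF assms(2), of A] by auto
  then show ?thesis using assms by (simp add: top_rem_coeff_eq_coeff_mod mod_mult_mult1)
next
  case False
  then have "degree (A mod M) \<le> degree M - 1" using degree_mod_less[OF assms(2), of A] by auto
  then have "coeff (C * (A mod M)) (degree C + (degree M - 1))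
      = lead_coeff C * coeff (A mod M) (degree M - 1)"
    by (rule coeff_mult_degree_add)
  then show ?thesis
    using assms False by (simp add: top_rem_coeff_eq_coeff_mod mod_mult_mult1 degree_mult_eq)
qed

lemma top_rem_coeff_mult_surj:
  fixes M G :: "'a::field poly"
  assumes "M \<noteq> 0" and "\<not> M dvd G"
  obtains R where "top_rem_coeff M (G * R) = x"
proof
  define g where "g = G mod M"
  define R where "R = monom (x / lead_coeff g) (degree M - 1 - degree g)"
  have g: "g \<noteq> 0" "degree g < degree M"
    using assms degree_mod_less[of M G] by (auto simp: g_def dvd_eq_mod_eq_0)
  have "degree (g * R) \<le> degree g + (degree M - 1 - degree g)"
    unfolding R_def by (meson add_left_mono degree_monom_le degree_mult_le le_trans)
  then have "degree (g * R) < degree M" using g(2) by linarith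
  then have "(G * R) mod M = g * R" by (metis g_def mod_mult_left_eq mod_poly_less)
  moreover have "coeff (g * R) (degree M - 1) = x"
    using g by (simp add: R_def mult.commute[of g] coeff_monom_mult)
  ultimately show "top_rem_coeff M (G * R) = x"
    using assms(1) by (simp add: top_rem_coeff_eq_coeff_mod)
qed

lemma bij_betw_add_mod_remainders:
  "bij_betw (\<lambda>R. (R + A) mod M) (remainders M) (remainders M)"
proof (rule bij_betw_byWitness[where f' = "\<lambda>R. (R - A) mod M"])
  show "\<forall>R\<in>remainders M. ((R + A) mod M - A) mod M = R"
    "\<forall>R\<in>remainders M. ((R - A) mod M + A) mod M = R"
    by (auto simp: remainders_iff mod_simps)
qed (auto simp: remainders_iff)

lemma add_char_mult_mult:
  assumes "lead_coeff C = 1" and "M \<noteq> 0"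
  shows "add_char \<psi> G (C * M) (C * A) = add_char \<psi> G M A"
proof -
  have "C \<noteq> 0" using assms(1) by auto
  then show ?thesis
    using top_rem_coeff_mult_mult[OF _ assms(2), of C "G * A"] assms(1)
    by (simp add: add_char_def mult.left_commute)
qed

lemma poly_abs_mult: "poly_abs (A * B) = poly_abs A * poly_abs B"
  by (simp add: poly_abs_def degree_mult_eq power_add)

lemma poly_abs_power: "A \<noteq> 0 \<Longrightarrow> poly_abs (A ^ k) = poly_abs A ^ k"
  by (simp add: poly_abs_def degree_power_eq power_mult[symmetric] mult.commute)

locale nontrivial_additive_character =
  fixes \<psi> :: "'a::{finite,field} \<Rightarrow> complex"
  assumes nonzero: "\<psi> x \<noteq> 0"
    and add: "\<psi> (x + y) = \<psi> x * \<psi> y"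
    and nontrivial: "\<exists>x. \<psi> x \<noteq> 1"
begin

lemma map_zero: "\<psi> 0 = 1"
  using add[of 0 0] nonzero[of 0] by simp

lemma sum_add_char_remainders:
  assumes M: "M \<noteq> 0"
  shows "(\<Sum>R\<in>remainders M. add_char \<psi> G M R) = (if M dvd G then of_nat (poly_abs M) else 0)"
proof (cases "M dvd G")
  case True
  then have "add_char \<psi> G M R = 1" for R
    using M by (simp add: add_char_def top_rem_coeff_eq_coeff_mod map_zero)
  then show ?thesis using True M by (simp add: card_remainders)
next
  case False
  let ?s = "\<Sum>R\<in>remainders M. add_char \<psi> G M R"
  obtain x where x: "\<psi> x \<noteq> 1" using nontrivial by blast
  obtain A where A: "top_rem_coeff M (G * A) = x" using top_rem_coeff_mult_surj[OF M False] .
  have shift: "add_char \<psi> G M ((R + A) mod M) = \<psi> x * add_char \<psi> G M R" for R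
    by (simp add: add_char_def top_rem_coeff_mod_mult_right distrib_left top_rem_coeff_add add A)
  have "?s = (\<Sum>R\<in>remainders M. add_char \<psi> G M ((R + A) mod M))"
    by (rule sum.reindex_bij_betw[OF bij_betw_add_mod_remainders, symmetric])
  also have "\<dots> = \<psi> x * ?s" by (simp add: shift sum_distrib_left)
  finally show ?thesis using x False by simp
qed

section \<open>Divisor sums of \<open>\<eta>\<close>\<close>

lemma eta_divisor_sum_monic:
  assumes D: "lead_coeff D = 1" and k: "k > 0"
  shows "(\<Sum>d\<in>monic_divisors D. eta \<psi> k G d)
    = (if D ^ k dvd G then of_nat (poly_abs D) ^ k else 0)"
proof -
  have "eta \<psi> k G d = (\<Sum>R\<in>reduced_remainders k d. add_char \<psi> G (D ^ k) ((D div d) ^ k * R))"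
    if d: "d \<in> monic_divisors D" for d
  proof -
    have "d ^ k \<noteq> 0" "(D div d) ^ k * d ^ k = D ^ k"
      using d by (auto simp: monic_divisors_def power_mult_distrib[symmetric])
    moreover have "lead_coeff ((D div d) ^ k) = 1"
      using lead_coeff_div_monic[OF D d] by (simp add: lead_coeff_power)
    ultimately have "add_char \<psi> G (D ^ k) ((D div d) ^ k * R) = add_char \<psi> G (d ^ k) R" for R
      using add_char_mult_mult by metis
    then show ?thesis by (simp add: eta_eq_sum_reduced_remainders)
  qed
  then have "(\<Sum>d\<in>monic_divisors D. eta \<psi> k G d) = (\<Sum>R\<in>remainders (D ^ k). add_char \<psi> G (D ^ k) R)"
    by (simp add: sum_remainders_power[OF D k])
  moreover have "D \<noteq> 0" using D by auto
  ultimately show ?thesis by (simp add: sum_add_char_remainders poly_abs_power)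
qed

lemma eta_divisor_sum:
  assumes D: "D \<noteq> 0" and k: "k > 0"
  shows "(\<Sum>d\<in>monic_divisors D. eta \<psi> k G d)
    = (if D ^ k dvd G then of_nat (poly_abs D) ^ k else 0)"
proof -
  obtain C where C: "lead_coeff C = 1" "degree C = degree D" "C dvd D" "D dvd C"
    using monic_associateE[OF D] .
  have "monic_divisors D = monic_divisors C" using C(3,4) by (intro monic_divisors_cong)
  moreover have "C ^ k dvd G \<longleftrightarrow> D ^ k dvd G"
    using C(3,4)[THEN dvd_power_same, of k] by (metis dvd_trans)
  moreover have "poly_abs C = poly_abs D" using C(1,2) D by (auto simp: poly_abs_def)
  ultimately show ?thesis using eta_divisor_sum_monic[OF C(1) k, of G] by simp
qed

lemma eta_product_divisor_sum:
  assumes H: "H \<noteq> 0" and E: "E dvd H" and F: "F dvd H" and k: "k > 0"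
  shows "(\<Sum>d\<in>monic_divisors E. \<Sum>D\<in>monic_divisors H.
      eta \<psi> k ((H div D) ^ k) d * eta \<psi> k ((H div F) ^ k) D)
    = (if F dvd E then of_nat (poly_abs H) ^ k else 0)"
proof -
  have nz: "E \<noteq> 0" "F \<noteq> 0" "H div E \<noteq> 0" using H E F by (auto simp: dvd_div_eq_0_iff)
  have dvd: "H div E dvd H div F \<longleftrightarrow> F dvd E"
  proof -
    have "H div E dvd H div F \<longleftrightarrow> H div E * F dvd H div E * E"
      using F E nz(2) by (simp add: dvd_div_iff_mult)
    then show ?thesis using nz(3) by simp
  qed
  have "(\<Sum>d\<in>monic_divisors E. \<Sum>D\<in>monic_divisors H.
        eta \<psi> k ((H div D) ^ k) d * eta \<psi> k ((H div F) ^ k) D)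
      = (\<Sum>D\<in>monic_divisors H.
          (\<Sum>d\<in>monic_divisors E. eta \<psi> k ((H div D) ^ k) d) * eta \<psi> k ((H div F) ^ k) D)"
    by (subst sum.swap) (simp add: sum_distrib_right)
  also have "\<dots> = (\<Sum>D\<in>monic_divisors H.
      of_nat (poly_abs E) ^ k * (if E dvd H div D then eta \<psi> k ((H div F) ^ k) D else 0))"
    by (intro sum.cong refl)
      (simp add: eta_divisor_sum[OF nz(1) k] poly_power_dvd_power_iff[OF nz(1) k])
  also have "\<dots> = of_nat (poly_abs E) ^ k * (\<Sum>D\<in>monic_divisors (H div E). eta \<psi> k ((H div F) ^ k) D)"
    using H E by (simp add: monic_divisors_div sum.inter_filter finite_monic_divisors flip: sum_distrib_left)
  also have "\<dots> = (if F dvd E then of_nat (poly_abs E * poly_abs (H div E)) ^ k else 0)"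
    by (simp add: eta_divisor_sum[OF nz(3) k] poly_power_dvd_power_iff[OF nz(3) k] dvd
        power_mult_distrib)
  also have "poly_abs E * poly_abs (H div E) = poly_abs H"
    using E by (simp flip: poly_abs_mult)
  finally show ?thesis .
qed

end

theorem theorem4p1:
  fixes \<psi> :: "'a::{finite,field} \<Rightarrow> complex"
    and k :: nat
    and H D1 D2 :: "'a poly"
  assumes "\<And>x. \<psi> x \<noteq> 0"
    and "\<And>x y. \<psi> (x + y) = \<psi> x * \<psi> y"
    and "\<exists>x. \<psi> x \<noteq> 1"
    and "k \<ge> 1"
    and "H \<noteq> 0"
    and "lead_coeff D1 = 1" and "D1 dvd H"
    and "lead_coeff D2 = 1" and "D2 dvd H"
  shows "(\<Sum>D | lead_coeff D = 1 \<and> D dvd H. eta \<psi> k ((H div D) ^ k) D1 * eta \<psi> k ((H div D2) ^ k) D)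
    = (if D1 = D2 then of_nat (poly_abs H) ^ k else 0)"
proof -
  interpret nontrivial_additive_character \<psi>
    using assms(1-3) by unfold_locales
  define T where
    "T E = (\<Sum>D\<in>monic_divisors H. eta \<psi> k ((H div D) ^ k) E * eta \<psi> k ((H div D2) ^ k) D)" for E
  define U :: "'a poly \<Rightarrow> complex" where "U E = (if E = D2 then of_nat (poly_abs H) ^ k else 0)" for E
  have "sum T (monic_divisors E) = sum U (monic_divisors E)" if "E \<in> monic_divisors H" for E
  proof -
    have E: "E dvd H" "finite (monic_divisors E)"
      using that assms(5) finite_monic_divisors[of E] by (auto simp: monic_divisors_def)
    have "sum T (monic_divisors E) = (if D2 dvd E then of_nat (poly_abs H) ^ k else 0)"
      unfolding T_def using eta_product_divisor_sum[OF assms(5) E(1) assms(9)] assms(4) by simp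
    also have "\<dots> = sum U (monic_divisors E)"
      unfolding U_def using E(2) assms(8) by (simp add: monic_divisors_def)
    finally show ?thesis .
  qed
  moreover have "D1 \<in> monic_divisors H" using assms(6,7) by (simp add: monic_divisors_def)
  ultimately have "T D1 = U D1" by (rule eq_if_monic_divisor_sums_eq)
  then show ?thesis by (simp add: T_def U_def monic_divisors_def)
qed

end
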